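(* Let $G$ be a twin-free, cubic graph of order $n$. Then $\gamma_L(G) \le \frac{n}{2}$, where $\gamma_L(G)$ denotes the location-domination number of $G$.
   Context: All graphs are finite and simple. A graph is cubic if every vertex has degree exactly $3$. For a vertex $v$, $N(v)$ is its open neighborhood and $N[v]=N(v)\cup\{v\}$ its closed neighborhood. Two distinct vertices $u,v$ are twins if $N(u)=N(v)$ or $N[u]=N[v]$; a graph is twin-free if it has no twins. A set $D$ of vertices is dominating if every vertex outside $D$ has a neighbor in $D$. A locating-dominating set is a dominating set $D$ such that for every two distinct vertices $u,v \notin D$, $N(u)\cap D \ne N(v)\cap D$. The location-domination number $\gamma_L(G)$ is the minimum cardinality of a locating-dominating set of $G$. *)

theory Defs
  imports "HOL.Real" "Graph_Theory.Pair_Digraph"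
begin

text \<open>
  A finite simple graph is a \<^locale>\<open>pair_graph\<close>: a finite vertex set \<^const>\<open>pverts\<close> with a
  symmetric, irreflexive set \<^const>\<open>parcs\<close> of ordered pairs of vertices, so that an undirected
  edge \<open>uv\<close> is represented by the two arcs \<open>(u, v)\<close> and \<open>(v, u)\<close>.
\<close>

definition open_nbhd :: "'a pair_pre_digraph \<Rightarrow> 'a \<Rightarrow> 'a set" where
  "open_nbhd G v = {u \<in> pverts G. (v, u) \<in> parcs G}"

definition closed_nbhd :: "'a pair_pre_digraph \<Rightarrow> 'a \<Rightarrow> 'a set" where
  "closed_nbhd G v = open_nbhd G v \<union> {v}"

definition cubic :: "'a pair_pre_digraph \<Rightarrow> bool" where
  "cubic G \<longleftrightarrow> (\<forall>v \<in> pverts G. card (open_nbhd G v) = 3)"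

definition twins :: "'a pair_pre_digraph \<Rightarrow> 'a \<Rightarrow> 'a \<Rightarrow> bool" where
  "twins G u v \<longleftrightarrow>
     u \<in> pverts G \<and> v \<in> pverts G \<and> u \<noteq> v \<and>
     (open_nbhd G u = open_nbhd G v \<or> closed_nbhd G u = closed_nbhd G v)"

definition twin_free :: "'a pair_pre_digraph \<Rightarrow> bool" where
  "twin_free G \<longleftrightarrow> (\<nexists>u v. twins G u v)"

definition dominating_set :: "'a pair_pre_digraph \<Rightarrow> 'a set \<Rightarrow> bool" where
  "dominating_set G D \<longleftrightarrow>
     D \<subseteq> pverts G \<and> (\<forall>v \<in> pverts G - D. \<exists>u \<in> D. u \<in> open_nbhd G v)"

definition locating_dominating_set :: "'a pair_pre_digraph \<Rightarrow> 'a set \<Rightarrow> bool" where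
  "locating_dominating_set G D \<longleftrightarrow>
     dominating_set G D \<and>
     (\<forall>u \<in> pverts G - D. \<forall>v \<in> pverts G - D.
        u \<noteq> v \<longrightarrow> open_nbhd G u \<inter> D \<noteq> open_nbhd G v \<inter> D)"

definition location_domination_number :: "'a pair_pre_digraph \<Rightarrow> nat" where
  "location_domination_number G = Min (card ` {D. locating_dominating_set G D})"

text \<open>The minimum ranges over a finite nonempty set, so it is attained.\<close>

lemma locating_dominating_set_pverts: "locating_dominating_set G (pverts G)"
  by (simp add: locating_dominating_set_def dominating_set_def)

lemma (in pair_graph) finite_locating_dominating_sets:
  "finite {D. locating_dominating_set G D}"
  by (rule finite_subset[of _ "Pow (pverts G)"])
    (auto simp: locating_dominating_set_def dominating_set_def)

lemma (in pair_graph) location_domination_number_attained: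
  obtains D where "locating_dominating_set G D" "card D = location_domination_number G"
proof -
  have "location_domination_number G \<in> card ` {D. locating_dominating_set G D}"
    unfolding location_domination_number_def
    using finite_locating_dominating_sets locating_dominating_set_pverts
    by (intro Min_in) auto
  then show thesis using that by auto
qed

lemma (in pair_graph) location_domination_number_le:
  "locating_dominating_set G D \<Longrightarrow> location_domination_number G \<le> card D"
  unfolding location_domination_number_def
  using finite_locating_dominating_sets by (intro Min_le) auto

end

theory Submission
  imports Defs
begin

text \<open>
  Take a maximum cut. Every vertex has at least two neighbours across it, and twin-freeness
  implies that two vertices on the same side have the same neighbours across the cut only if they
  are opposite vertices of a 4-cycle, each with one neighbour on its own side. Maximality forces
  the other two vertices of this 4-cycle to have all their neighbours across the cut. Now move one
  vertex of each such pair to the other side, in such a way that no two adjacent vertices move;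
  this is possible because a union of two matchings is bipartite. Afterwards both sides are
  locating-dominating sets, and one of them has at most half of the vertices.
\<close>

section \<open>Two-colouring the union of two matchings\<close>

text \<open>The induction contracts the path \<open>g x, x, f x, g (f x)\<close> to a single \<open>g\<close>-edge.\<close>

lemma two_involutions_two_colourable:
  assumes "finite X"
    and "\<And>x. x \<in> X \<Longrightarrow> f x \<in> X \<and> f x \<noteq> x \<and> f (f x) = x"
    and "\<And>x. x \<in> X \<Longrightarrow> g x \<in> X \<and> g (g x) = x"
  shows "\<exists>S. \<forall>x\<in>X. (f x \<in> S \<longleftrightarrow> x \<notin> S) \<and> (g x \<noteq> x \<longrightarrow> (g x \<in> S \<longleftrightarrow> x \<notin> S))"
  using assms
proof (induction "card X" arbitrary: X g rule: less_induct)
  case less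
  note f = less.prems(2) and g = less.prems(3)
  show ?case
  proof (cases "X = {}")
    case False
    then obtain x where x: "x \<in> X" by blast
    define y where "y = f x"
    have y: "y \<in> X" "y \<noteq> x" "f y = x" using f[OF x] by (auto simp: y_def)
    define X' where "X' = X - {x, y}"
    \<comment> \<open>If one end of the contracted path is missing, the other end becomes a fixed
      point of \<open>g'\<close> and so carries no condition.\<close>
    define g' where "g' w =
      (if g w = x then if g y \<in> X' then g y else w
       else if g w = y then if g x \<in> X' then g x else w else g w)" for w
    have "card X' < card X"
      unfolding X'_def using x less.prems(1) by (intro psubset_card_mono) auto
    moreover have "finite X'" using less.prems(1) by (simp add: X'_def)
    moreover have "f w \<in> X' \<and> f w \<noteq> w \<and> f (f w) = w" if "w \<in> X'" for w
      using that f[of w] f[OF x] y by (auto simp: X'_def y_def)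
    moreover have "g' w \<in> X' \<and> g' (g' w) = w" if "w \<in> X'" for w
      using that g[of w] g[OF x] g[OF y(1)] y(2) by (auto simp: X'_def g'_def)
    ultimately have "\<exists>S. \<forall>w\<in>X'. (f w \<in> S \<longleftrightarrow> w \<notin> S) \<and> (g' w \<noteq> w \<longrightarrow> (g' w \<in> S \<longleftrightarrow> w \<notin> S))"
      by (rule less.hyps)
    then obtain S where "\<forall>w\<in>X'. (f w \<in> S \<longleftrightarrow> w \<notin> S) \<and> (g' w \<noteq> w \<longrightarrow> (g' w \<in> S \<longleftrightarrow> w \<notin> S))" ..
    note S = bspec[OF this]
    \<comment> \<open>\<open>b\<close> is the membership of \<open>x\<close> in the new colour
      class, forced by \<open>g x\<close> if that vertex remains, otherwise by \<open>g y\<close>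
      through \<open>y\<close>.\<close>
    define b where "b \<longleftrightarrow> (if g x \<in> X' then g x \<notin> S else g y \<in> X' \<longrightarrow> g y \<in> S)"
    define T where "T = (S - {x, y}) \<union> (if b then {x} else {y})"
    have Tx: "x \<in> T \<longleftrightarrow> b" "y \<in> T \<longleftrightarrow> \<not> b" using y(2) by (auto simp: T_def)
    have TX': "w \<in> T \<longleftrightarrow> w \<in> S" if "w \<in> X'" for w using that by (auto simp: T_def X'_def)
    have bx: "g x \<in> S \<longleftrightarrow> \<not> b" if "g x \<in> X'" using that by (simp add: b_def)
    have by': "g y \<in> S \<longleftrightarrow> b" if gy: "g y \<in> X'"
    proof (cases "g x \<in> X'")
      case True
      \<comment> \<open>Both outer ends remain, so \<open>g'\<close> matches them and
        \<open>S\<close> separates them. The colours forced on \<open>x\<close> and \<open>y\<close>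
        are then opposite, as \<open>f\<close> requires.\<close>
      have ggx: "g (g x) = x" and ggy: "g (g y) = y" using g x y(1) by auto
      have "g y \<noteq> g x" using ggx ggy y(2) by metis
      moreover have "g' (g x) = g y" using ggx gy by (simp add: g'_def)
      ultimately have "g y \<in> S \<longleftrightarrow> g x \<notin> S" using S[OF True] by simp
      then show ?thesis using True by (simp add: b_def)
    qed (use gy in \<open>simp add: b_def\<close>)
    have "(f w \<in> T \<longleftrightarrow> w \<notin> T) \<and> (g w \<noteq> w \<longrightarrow> (g w \<in> T \<longleftrightarrow> w \<notin> T))" if w: "w \<in> X" for w
    proof -
      consider "w = x" | "w = y" | "w \<in> X'" using w by (auto simp: X'_def)
      then show ?thesis
      proof cases
        case 1
        have "g x \<in> X' \<or> g x = x \<or> g x = y" using g[OF x] by (auto simp: X'_def)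
        then show ?thesis using 1 Tx bx TX' by (auto simp: y_def)
      next
        case 2
        have "g y \<in> X' \<or> g y = x \<or> g y = y" using g[OF y(1)] by (auto simp: X'_def)
        then show ?thesis using 2 Tx by' TX' y(3) by auto
      next
        case 3
        have "f w \<in> X'" using 3 f[of w] f[OF x] y by (auto simp: X'_def y_def)
        then have "f w \<in> T \<longleftrightarrow> w \<notin> T" using S[OF 3] TX' 3 by simp
        moreover have "g w \<in> T \<longleftrightarrow> w \<notin> T" if ne: "g w \<noteq> w"
        proof -
          have ggw: "g (g w) = w" using g w by blast
          consider "g w = x" | "g w = y" | "g w \<in> X'" using g[OF w] by (auto simp: X'_def)
          then show ?thesis
          proof cases
            case 1
            then show ?thesis using Tx TX'[OF 3] bx 3 ggw by auto
          next
            case 2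
            then show ?thesis using Tx TX'[OF 3] by' 3 ggw by auto
          next
            case 4: 3
            then have "g' w = g w" by (auto simp: g'_def X'_def)
            then show ?thesis using S[OF 3] ne TX' 3 4 by simp
          qed
        qed
        ultimately show ?thesis by blast
      qed
    qed
    then show ?thesis by blast
  qed simp
qed

section \<open>Cuts in twin-free cubic graphs\<close>

locale twin_free_cubic_graph = pair_graph G for G :: "'a pair_pre_digraph" +
  assumes twin_free: "twin_free G" and cubic: "cubic G"
begin

abbreviation "V \<equiv> pverts G"
abbreviation "N \<equiv> open_nbhd G"

lemma N_subset: "w \<in> N v \<Longrightarrow> w \<in> V"
  by (simp add: open_nbhd_def)

lemma finite_N [simp]: "finite (N v)"
  by (rule finite_subset[of _ V]) (auto simp: open_nbhd_def)

lemma card_N: "v \<in> V \<Longrightarrow> card (N v) = 3"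
  using cubic by (simp add: cubic_def)

lemma N_sym: "w \<in> N v \<Longrightarrow> v \<in> N w"
  using in_arcsD1 arcs_symmetric by (auto simp: open_nbhd_def)

lemma N_irrefl [simp]: "v \<notin> N v"
  using no_loops' by (auto simp: open_nbhd_def)

lemma N_inj: "u \<in> V \<Longrightarrow> v \<in> V \<Longrightarrow> N u = N v \<Longrightarrow> u = v"
  using twin_free by (auto simp: twin_free_def twins_def)

lemma closed_N_inj: "u \<in> V \<Longrightarrow> v \<in> V \<Longrightarrow> insert u (N u) = insert v (N v) \<Longrightarrow> u = v"
  using twin_free by (auto simp: twin_free_def twins_def closed_nbhd_def)

definition cross :: "('a \<Rightarrow> bool) \<Rightarrow> 'a \<Rightarrow> 'a set" where
  "cross s v = {w \<in> N v. s w \<noteq> s v}"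

text \<open>A bipartition is a predicate \<open>s\<close> giving each vertex its side. Each crossing
  edge contributes both of its arcs, so \<open>card (cut s)\<close> is twice the usual size of the
  cut.\<close>

definition cut :: "('a \<Rightarrow> bool) \<Rightarrow> ('a \<times> 'a) set" where
  "cut s = {(v, w) \<in> parcs G. s v \<noteq> s w}"

definition flip :: "'a \<Rightarrow> ('a \<Rightarrow> bool) \<Rightarrow> 'a \<Rightarrow> bool" where
  "flip v s = s(v := \<not> s v)"

lemma finite_cross [simp]: "finite (cross s v)"
  by (simp add: cross_def)

lemma finite_cut: "finite (cut s)"
  by (rule finite_subset[of _ "parcs G"]) (auto simp: cut_def)

lemma cross_flip_self: "cross (flip v s) v = N v - cross s v"
  by (auto simp: cross_def flip_def)

text \<open>Isolates the arcs at \<open>v\<close>: the remaining ones do not depend on the side of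
  \<open>v\<close>, so two bipartitions differing only at \<open>v\<close> can be compared.\<close>

lemma card_cut_split:
  assumes "v \<in> V"
  shows "card (cut s) = card {(x, y) \<in> cut s. x \<noteq> v \<and> y \<noteq> v} + 2 * card (cross s v)"
proof -
  let ?R = "{(x, y) \<in> cut s. x \<noteq> v \<and> y \<noteq> v}"
  let ?A = "Pair v ` cross s v" and ?B = "(\<lambda>w. (w, v)) ` cross s v"
  have "(v, w) \<in> cut s \<longleftrightarrow> w \<in> cross s v" for w
    using in_arcsD2 by (auto simp: cut_def cross_def open_nbhd_def)
  moreover have "(w, v) \<in> cut s \<longleftrightarrow> (v, w) \<in> cut s" for w
    using arcs_symmetric by (auto simp: cut_def)
  ultimately have eq: "cut s = ?R \<union> (?A \<union> ?B)" by blast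
  have "card ?A = card (cross s v)" "card ?B = card (cross s v)"
    by (auto intro!: card_image inj_onI)
  moreover have "?A \<inter> ?B = {}" by (auto simp: cross_def)
  moreover have "finite ?R" using finite_cut by (rule finite_subset[rotated]) auto
  moreover have "?R \<inter> (?A \<union> ?B) = {}" by auto
  ultimately have "card (?R \<union> (?A \<union> ?B)) = card ?R + 2 * card (cross s v)"
    by (simp add: card_Un_disjoint)
  then show ?thesis using eq by simp
qed

lemma card_cut_flip:
  assumes "v \<in> V"
  shows "card (cut (flip v s)) + 2 * card (cross s v) = card (cut s) + 2 * card (N v - cross s v)"
proof -
  have "{(x, y) \<in> cut (flip v s). x \<noteq> v \<and> y \<noteq> v} = {(x, y) \<in> cut s. x \<noteq> v \<and> y \<noteq> v}"
    by (auto simp: cut_def flip_def)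
  then show ?thesis
    using card_cut_split[OF assms, of s] card_cut_split[OF assms, of "flip v s"]
    by (simp add: cross_flip_self)
qed

text \<open>With degree 3, moving a vertex with \<open>k\<close> crossing edges changes the count by
  \<open>6 - 4 * k\<close>. The additive form avoids truncated subtraction.\<close>

lemma card_cut_flip':
  assumes "v \<in> V"
  shows "card (cut (flip v s)) + 4 * card (cross s v) = card (cut s) + 6"
proof -
  have "card (N v - cross s v) = 3 - card (cross s v)"
    using card_N[OF assms] by (simp add: card_Diff_subset cross_def)
  moreover have "card (cross s v) \<le> 3"
    using card_mono[of "N v" "cross s v"] card_N[OF assms] by (auto simp: cross_def)
  ultimately show ?thesis using card_cut_flip[OF assms, of s] by simp
qed

text \<open>There may be infinitely many predicates on \<open>'a\<close>, so the maximum comes from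
  the bound by the number of arcs.\<close>

lemma ex_max_cut: "\<exists>s. \<forall>t. card (cut t) \<le> card (cut s)"
proof -
  have "\<forall>t. card (cut t) < Suc (card (parcs G))"
    by (auto simp: less_Suc_eq_le cut_def intro!: card_mono)
  then show ?thesis
    using ex_has_greatest_nat[of "\<lambda>_. True" _ "\<lambda>t. card (cut t)"] by simp
qed

text \<open>A vertex outside the side \<open>c\<close> sees in that side exactly its neighbours
  across the cut, and any two such vertices lie on one common side.\<close>

lemma locating_dominating_setI:
  assumes "\<And>v. v \<in> V \<Longrightarrow> cross t v \<noteq> {}"
    and "\<And>u v. u \<in> V \<Longrightarrow> v \<in> V \<Longrightarrow> u \<noteq> v \<Longrightarrow> t u = t v \<Longrightarrow> cross t u \<noteq> cross t v"
  shows "locating_dominating_set G {v \<in> V. t v = c}"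
proof -
  let ?D = "{v \<in> V. t v = c}"
  have eq: "N v \<inter> ?D = cross t v" if "v \<in> V - ?D" for v
    using that N_subset by (auto simp: cross_def)
  have "\<exists>u\<in>?D. u \<in> N v" if "v \<in> V - ?D" for v
    using eq[OF that] assms(1)[of v] that by blast
  moreover have "N u \<inter> ?D \<noteq> N v \<inter> ?D" if "u \<in> V - ?D" "v \<in> V - ?D" "u \<noteq> v" for u v
    using eq[OF that(1)] eq[OF that(2)] assms(2)[of u v] that by auto
  ultimately show ?thesis
    by (auto simp: locating_dominating_set_def dominating_set_def)
qed

end

section \<open>Maximum cuts and their conflicts\<close>

locale max_cut = twin_free_cubic_graph +
  fixes s :: "'a \<Rightarrow> bool"
  assumes max_cut: "card (cut t) \<le> card (cut s)"
begin

text \<open>With at most one crossing edge at \<open>v\<close>, moving \<open>v\<close> would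
  enlarge the cut.\<close>

lemma card_cross_ge: "v \<in> V \<Longrightarrow> 2 \<le> card (cross s v)"
  using card_cut_flip'[of v s] max_cut[of "flip v s"] by linarith

text \<open>At most one of the three edges at \<open>v\<close> fails to cross, so the edges inside
  the sides form a matching.\<close>

lemma same_side_unique:
  assumes "v \<in> V" "x \<in> N v" "y \<in> N v" "s x = s v" "s y = s v"
  shows "x = y"
proof (rule ccontr)
  assume "x \<noteq> y"
  have "card (cross s v) \<le> card (N v - {x, y})"
    using assms by (intro card_mono) (auto simp: cross_def)
  also have "\<dots> = 1"
    using assms \<open>x \<noteq> y\<close> card_N by (simp add: card_Diff_subset)
  finally show False using card_cross_ge[OF assms(1)] by simp
qed

text \<open>By \<open>card_cross_ge\<close> both sides already dominate, so these pairs are the only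
  obstruction to their being locating-dominating.\<close>

definition conflict :: "'a \<Rightarrow> 'a \<Rightarrow> bool" where
  "conflict x y \<longleftrightarrow> x \<in> V \<and> y \<in> V \<and> x \<noteq> y \<and> s x = s y \<and> cross s x = cross s y"

lemma conflict_sym: "conflict x y \<Longrightarrow> conflict y x"
  by (auto simp: conflict_def)

text \<open>Three common crossing neighbours would be the whole of \<open>N x\<close> and of
  \<open>N y\<close>, making \<open>x\<close> and \<open>y\<close> open twins.\<close>

lemma conflict_card_cross:
  assumes "conflict x y"
  shows "card (cross s x) = 2"
proof (rule ccontr)
  assume "card (cross s x) \<noteq> 2"
  moreover have sub: "cross s x \<subseteq> N x" "cross s x \<subseteq> N y"
    using assms by (auto simp: conflict_def cross_def)
  ultimately have "card (cross s x) = 3"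
    using card_cross_ge[of x] card_mono[OF finite_N sub(1)] card_N[of x] assms
    by (simp add: conflict_def)
  then have "cross s x = N x" "cross s x = N y"
    using assms card_subset_eq[OF _ sub(1)] card_subset_eq[OF _ sub(2)] card_N
    by (simp_all add: conflict_def)
  then show False using assms N_inj by (auto simp: conflict_def)
qed

text \<open>If the same-side neighbour \<open>e\<close> of \<open>x\<close> were \<open>y\<close>,
  then \<open>x\<close> and \<open>y\<close> would be closed twins. Hence vertices in conflict are
  not adjacent.\<close>

lemma conflict_N:
  assumes "conflict x y"
  obtains e where "N x = insert e (cross s x)" "e \<notin> cross s x" "s e = s x" "e \<noteq> y"
proof -
  have V: "x \<in> V" "y \<in> V" and "x \<noteq> y" using assms by (auto simp: conflict_def)
  have sub: "cross s x \<subseteq> N x" by (auto simp: cross_def)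
  have "card (N x - cross s x) = 1"
    using card_N[OF V(1)] conflict_card_cross[OF assms] sub by (simp add: card_Diff_subset)
  then obtain e where e: "N x - cross s x = {e}" by (rule card_1_singletonE)
  then have "N x = insert e (cross s x)" using sub by blast
  moreover from e have "e \<in> N x" "e \<notin> cross s x" by auto
  ultimately have 1: "N x = insert e (cross s x)" "e \<notin> cross s x" "s e = s x"
    by (simp_all add: cross_def)
  have "e \<noteq> y"
  proof
    assume "e = y"
    have sub': "insert x (cross s x) \<subseteq> N y"
    proof -
      have "x \<in> N y" using 1(1) \<open>e = y\<close> N_sym by blast
      moreover have "cross s x \<subseteq> N y" using assms by (auto simp: conflict_def cross_def)
      ultimately show ?thesis by simp
    qed
    have "card (insert x (cross s x)) = 3"
      using conflict_card_cross[OF assms] by (simp add: cross_def)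
    then have "N y = insert x (cross s x)"
      using card_subset_eq[OF _ sub'] card_N[OF V(2)] by simp
    then show False using closed_N_inj[OF V] 1 \<open>e = y\<close> \<open>x \<noteq> y\<close> by auto
  qed
  then show thesis using that 1 by blast
qed

text \<open>Otherwise \<open>x\<close> and \<open>y\<close> are the only crossing neighbours of
  \<open>a\<close>. Moving \<open>x\<close>, then \<open>y\<close>, then \<open>a\<close> changes
  the arc count by -2, -2 and +6, contradicting maximality.\<close>

lemma conflict_cross_full:
  assumes xy: "conflict x y" and a: "a \<in> cross s x"
  shows "cross s a = N a"
proof (rule ccontr)
  assume nfull: "cross s a \<noteq> N a"
  have V: "x \<in> V" "y \<in> V" "a \<in> V" and ne: "x \<noteq> y"
    using assms N_subset by (auto simp: conflict_def cross_def)
  have ayx: "a \<in> cross s y" "s x = s y" using xy a by (auto simp: conflict_def)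
  obtain e where "N x = insert e (cross s x)" "e \<noteq> y" by (rule conflict_N[OF xy])
  moreover have "y \<notin> cross s x" using ayx by (simp add: cross_def)
  ultimately have yNx: "y \<notin> N x" by simp
  have "{x, y} \<subseteq> cross s a"
    using a ayx N_sym by (auto simp: cross_def)
  moreover have "card (cross s a) < 3"
    using psubset_card_mono[of "N a" "cross s a"] nfull card_N[OF V(3)]
    by (auto simp: cross_def)
  ultimately have cra: "cross s a = {x, y}"
    using ne by (intro card_seteq[symmetric]) auto
  have 1: "card (cut (flip x s)) + 2 = card (cut s)"
    using card_cut_flip'[OF V(1), of s] conflict_card_cross[OF xy] by simp
  \<comment> \<open>Non-adjacency of \<open>x\<close> and \<open>y\<close> makes the second move
    cost the same as the first.\<close>
  have "cross (flip x s) y = cross s y"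
    using yNx N_sym ne by (auto simp: cross_def flip_def)
  then have 2: "card (cut (flip y (flip x s))) + 4 = card (cut s)"
    using card_cut_flip'[OF V(2), of "flip x s"] conflict_card_cross[OF xy] xy 1
    by (simp add: conflict_def)
  have "cross (flip y (flip x s)) a = {}"
    using cra ne a ayx by (auto simp: cross_def flip_def)
  then have "card (cut (flip a (flip y (flip x s)))) = card (cut s) + 2"
    using card_cut_flip'[OF V(3), of "flip y (flip x s)"] 2 by simp
  then show False using max_cut[of "flip a (flip y (flip x s))"] by simp
qed

lemma conflict_cross_N:
  assumes xy: "conflict x y" and a: "a \<in> cross s x"
  obtains a' where "N a = {x, y, a'}" "a' \<noteq> x" "a' \<noteq> y"
proof -
  have "a \<in> cross s y" using assms by (simp add: conflict_def)
  then have "a \<in> V" "{x, y} \<subseteq> N a" "x \<noteq> y"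
    using assms N_sym N_subset by (auto simp: conflict_def cross_def)
  moreover from this have "card (N a - {x, y}) = 1"
    by (simp add: card_N card_Diff_subset)
  then obtain a' where "N a - {x, y} = {a'}" by (rule card_1_singletonE)
  ultimately show thesis using that[of a'] by blast
qed

text \<open>With distinct \<open>y\<close> and \<open>z\<close>, both crossing neighbours of
  \<open>x\<close> would have neighbourhood \<open>{x, y, z}\<close> and be open twins.\<close>

lemma conflict_unique:
  assumes xy: "conflict x y" and xz: "conflict x z"
  shows "y = z"
proof (rule ccontr)
  assume "y \<noteq> z"
  obtain a b where ab: "cross s x = {a, b}" "a \<noteq> b"
    using conflict_card_cross[OF xy] by (auto simp: card_2_iff)
  have "N c = {x, y, z}" if c: "c \<in> cross s x" for c
  proof -
    obtain c' where "N c = {x, y, c'}" by (rule conflict_cross_N[OF xy c])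
    moreover have "c \<in> cross s z" using xz c by (simp add: conflict_def)
    then have "z \<in> N c" using N_sym by (simp add: cross_def)
    ultimately show ?thesis using \<open>y \<noteq> z\<close> xz by (auto simp: conflict_def)
  qed
  then have "N a = N b" using ab by auto
  moreover have "a \<in> V" "b \<in> V" using ab N_subset by (auto simp: cross_def)
  ultimately show False using ab N_inj by auto
qed

section \<open>Choosing the vertices to move\<close>

definition X :: "'a set" where
  "X = {x. \<exists>y. conflict x y}"

definition partner :: "'a \<Rightarrow> 'a" where
  "partner x = (SOME y. conflict x y)"

lemma conflict_partner: "x \<in> X \<Longrightarrow> conflict x (partner x)"
  unfolding X_def partner_def by (simp add: someI_ex)

lemma conflict_imp_partner: "conflict x y \<Longrightarrow> partner x = y"
  using conflict_unique[OF conflict_partner, of x y] unfolding X_def by blast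

lemma X_subset: "X \<subseteq> V"
  by (auto simp: X_def conflict_def)

text \<open>A vertex in conflict has only two crossing edges. With
  \<open>conflict_cross_full\<close>, no edge between two vertices of \<open>X\<close> crosses the
  cut.\<close>

lemma cross_full_notin_X: "cross s a = N a \<Longrightarrow> a \<notin> X"
  using conflict_card_cross[OF conflict_partner, of a] card_N[of a] X_subset by auto

text \<open>A set of vertices such that moving it across the cut resolves all conflicts.\<close>

lemma ex_resolving_set:
  obtains S where "S \<subseteq> X"
    and "\<And>x y. conflict x y \<Longrightarrow> y \<in> S \<longleftrightarrow> x \<notin> S"
    and "\<And>x y. x \<in> S \<Longrightarrow> y \<in> S \<Longrightarrow> y \<notin> N x"
proof -
  have V: "x \<in> V" if "x \<in> X" for x using that X_subset by auto
  \<comment> \<open>The second matching: the edges inside the sides with both ends in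
    \<open>X\<close>. \<open>same_side_unique\<close> makes \<open>THE\<close> well defined, and
    vertices without such an edge are fixed.\<close>
  define g where "g x = (if \<exists>e\<in>X \<inter> N x. s e = s x then THE e. e \<in> X \<inter> N x \<and> s e = s x else x)" for x
  have g_eq: "g x = e" if "x \<in> V" "e \<in> X" "e \<in> N x" "s e = s x" for x e
  proof -
    have "(THE e. e \<in> X \<inter> N x \<and> s e = s x) = e"
      using that same_side_unique[of x] by (intro the_equality) blast+
    moreover have "\<exists>e\<in>X \<inter> N x. s e = s x" using that by blast
    ultimately show ?thesis by (simp add: g_def)
  qed
  have "partner x \<in> X \<and> partner x \<noteq> x \<and> partner (partner x) = x" if "x \<in> X" for x
    using conflict_sym[OF conflict_partner[OF that]] conflict_imp_partner
    by (auto simp: X_def conflict_def)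
  moreover have "g x \<in> X \<and> g (g x) = x" if x: "x \<in> X" for x
  proof (cases "\<exists>e\<in>X \<inter> N x. s e = s x")
    case True
    then obtain e where e: "e \<in> X" "e \<in> N x" "s e = s x" by auto
    then have "g x = e" "g e = x" using x V N_sym by (auto intro!: g_eq)
    then show ?thesis using e by simp
  qed (use x in \<open>auto simp: g_def\<close>)
  moreover have "finite X" using X_subset by (rule finite_subset) simp
  ultimately obtain S where S: "\<forall>x\<in>X. (partner x \<in> S \<longleftrightarrow> x \<notin> S) \<and>
      (g x \<noteq> x \<longrightarrow> (g x \<in> S \<longleftrightarrow> x \<notin> S))"
    using two_involutions_two_colourable[of X partner g] by auto
  show thesis
  \<comment> \<open>The colouring says nothing about \<open>S\<close> outside \<open>X\<close>,
    hence the intersection.\<close>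
  proof (rule that[of "S \<inter> X"])
    fix x y assume xy: "conflict x y"
    then show "y \<in> S \<inter> X \<longleftrightarrow> x \<notin> S \<inter> X"
      using S conflict_imp_partner[OF xy] conflict_sym[OF xy] by (auto simp: X_def)
  next
    fix x y assume x: "x \<in> S \<inter> X" and y: "y \<in> S \<inter> X"
    show "y \<notin> N x"
    proof
      assume yx: "y \<in> N x"
      show False
      proof (cases "s y = s x")
        case True
        then have "g x = y" using x y yx V by (intro g_eq) auto
        moreover from this have "g x \<noteq> x" using yx by auto
        ultimately show False using S x y by auto
      next
        case False
        then have "y \<in> cross s x" using yx by (simp add: cross_def)
        then have "y \<notin> X" using conflict_cross_full conflict_partner cross_full_notin_X x by blast
        then show False using y by simp
      qed
    qed
  qed auto
qed

section \<open>The bipartition after the moves\<close>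

lemma ex_locating_dominating_bipartition:
  "\<exists>t :: 'a \<Rightarrow> bool. \<forall>c. locating_dominating_set G {v \<in> V. t v = c}"
proof -
  obtain S where SX: "S \<subseteq> X" and S1: "\<And>x y. conflict x y \<Longrightarrow> y \<in> S \<longleftrightarrow> x \<notin> S"
    and S2: "\<And>x y. x \<in> S \<Longrightarrow> y \<in> S \<Longrightarrow> y \<notin> N x"
    by (rule ex_resolving_set) blast
  \<comment> \<open>Exclusive or: exactly the vertices of \<open>S\<close> change sides.\<close>
  define t where "t v = (s v \<noteq> (v \<in> S))" for v
  \<comment> \<open>A moved vertex keeps as its only crossing neighbour its former same-side
    neighbour \<open>e\<close>, because no other neighbour moves.\<close>
  have moved: "\<exists>e. cross t x = {e} \<and> e \<in> V \<and> e \<notin> S \<and> x \<in> N e \<and> s e = s x" if x: "x \<in> S" for x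
  proof -
    have c: "conflict x (partner x)" using x SX conflict_partner by auto
    obtain e where e: "N x = insert e (cross s x)" "s e = s x"
      by (rule conflict_N[OF c])
    have "e \<notin> S" using S2[OF x] e(1) by blast
    have "a \<notin> S" if "a \<in> cross s x" for a
      using conflict_cross_full[OF c that] cross_full_notin_X SX by auto
    then have "t w = t x" if "w \<in> cross s x" for w
      using that x by (auto simp: t_def cross_def)
    then have "cross t x \<subseteq> {e}" using e(1) by (auto simp: cross_def[of t])
    moreover have eN: "e \<in> N x" using e(1) by blast
    then have "e \<in> cross t x" using x e(2) \<open>e \<notin> S\<close> by (simp add: t_def cross_def)
    ultimately have "cross t x = {e}" by blast
    moreover have "e \<in> V" "x \<in> N e" using N_subset N_sym eN by auto
    ultimately show ?thesis using e \<open>e \<notin> S\<close> by blast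
  qed
  \<comment> \<open>The three cases: a same-side neighbour of \<open>z\<close> moved away, no
    neighbour moved, or one crossing neighbour \<open>x\<close> moved over to the side of
    \<open>z\<close>.\<close>
  have unmoved: "cross t z = N z \<or> cross t z = cross s z \<or>
      (\<exists>x y a'. conflict x y \<and> z \<in> cross s x \<and> N z = {x, y, a'} \<and> cross t z = {y, a'} \<and> y \<noteq> a')"
    if z: "z \<in> V" "z \<notin> S" for z
  proof (cases "S \<inter> N z = {}")
    case True
    then have "cross t z = cross s z" using z by (auto simp: t_def cross_def)
    then show ?thesis by simp
  next
    case False
    then obtain x where x: "x \<in> S" "x \<in> N z" by auto
    have c: "conflict x (partner x)" using x SX conflict_partner by auto
    show ?thesis
    proof (cases "s x = s z")
      case True
      have "w \<in> cross t z" if w: "w \<in> N z" for w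
      proof (cases "w = x")
        case True
        then show ?thesis using \<open>s x = s z\<close> x z by (simp add: t_def cross_def)
      next
        case False
        then have sw: "s w \<noteq> s z" using same_side_unique[of z x w] z x w True by auto
        \<comment> \<open>If \<open>w\<close> moved, \<open>conflict_cross_full\<close> would forbid
          \<open>z\<close> its same-side neighbour \<open>x\<close>.\<close>
        have "w \<notin> S"
        proof
          assume "w \<in> S"
          then have "conflict w (partner w)" using SX conflict_partner by auto
          moreover have "z \<in> cross s w" using sw w N_sym by (auto simp: cross_def)
          ultimately have "cross s z = N z" using conflict_cross_full by blast
          then show False using x True by (auto simp: cross_def)
        qed
        then show ?thesis using sw w z by (simp add: t_def cross_def)
      qed
      then have "cross t z = N z" by (auto simp: cross_def)
      then show ?thesis by simp
    next
      case False
      then have zx: "z \<in> cross s x" using x N_sym by (auto simp: cross_def)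
      obtain a' where a': "N z = {x, partner x, a'}" "a' \<noteq> x" "a' \<noteq> partner x"
        using conflict_cross_N[OF c zx] .
      have full: "cross s z = N z" using conflict_cross_full[OF c zx] .
      \<comment> \<open>If \<open>a'\<close> moved, its partner would also be adjacent to
        \<open>z\<close>, hence be \<open>x\<close> or \<open>partner x\<close>; uniqueness of
        partners excludes both.\<close>
      have "a' \<notin> S"
      proof
        assume "a' \<in> S"
        then have c': "conflict a' (partner a')" using SX conflict_partner by auto
        have "s a' \<noteq> s z" "a' \<in> N z" using full a' by (auto simp: cross_def)
        then have "z \<in> cross s a'" using N_sym by (auto simp: cross_def)
        then have "partner a' \<in> N z" using c' N_sym by (auto simp: conflict_def cross_def)
        then have "partner a' = x \<or> partner a' = partner x"
          using a' c' by (auto simp: conflict_def)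
        then show False
          using conflict_sym[OF c'] conflict_sym[OF c] conflict_unique c a' by metis
      qed
      moreover have "partner x \<notin> S" using S1[OF c] x by simp
      moreover have "s w \<noteq> s z" if "w \<in> N z" for w using that full by (auto simp: cross_def)
      ultimately have "cross t z = {partner x, a'}"
        using a' x z by (auto simp: t_def cross_def)
      then show ?thesis using c zx a' by metis
    qed
  qed
  have card_unmoved: "2 \<le> card (cross t z)" if "z \<in> V" "z \<notin> S" for z
    using unmoved[OF that] card_N[OF that(1)] card_cross_ge[OF that(1)] by auto
  \<comment> \<open>Here \<open>p\<close> lost \<open>x\<close> but kept \<open>y\<close>. Since
    \<open>q\<close> also sees \<open>y\<close> across the original cut, it is adjacent to
    \<open>x\<close> too, and \<open>p\<close>, \<open>q\<close> become open twins.\<close>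
  have no_mid: False
    if p: "p \<in> V" "p \<notin> S" and q: "q \<in> V" "q \<notin> S" and pq: "p \<noteq> q" "s p = s q"
      and eq: "cross t p = cross t q"
      and c: "conflict x y" "p \<in> cross s x" "N p = {x, y, a'}" "cross t p = {y, a'}" for p q x y a'
  proof -
    have py: "p \<in> cross s y" using c by (auto simp: conflict_def)
    have "y \<in> N q" "a' \<in> N q" using eq c(4) by (auto simp: cross_def)
    moreover have "s q \<noteq> s y" using py pq(2) by (auto simp: cross_def)
    ultimately have "q \<in> cross s y" using N_sym by (auto simp: cross_def)
    then have "q \<in> cross s x" using c(1) by (simp add: conflict_def)
    then have "x \<in> N q" using N_sym by (auto simp: cross_def)
    then have sub: "N p \<subseteq> N q" using c(3) \<open>y \<in> N q\<close> \<open>a' \<in> N q\<close> by auto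
    then have "N p = N q" using card_N p(1) q(1) by (intro card_subset_eq) auto
    then show False using N_inj p(1) q(1) pq(1) by auto
  qed
  have "cross t v \<noteq> {}" if "v \<in> V" for v
    using moved card_unmoved[OF that] by (cases "v \<in> S") fastforce+
  moreover have "cross t p \<noteq> cross t q"
    if pV: "p \<in> V" and qV: "q \<in> V" and ne: "p \<noteq> q" and tpq: "t p = t q" for p q
  proof
    assume eq: "cross t p = cross t q"
    consider "p \<in> S" "q \<in> S" | "p \<in> S" "q \<notin> S" | "p \<notin> S" "q \<in> S" | "p \<notin> S" "q \<notin> S"
      by blast
    then show False
    proof cases
      case 1
      then obtain e where "cross t p = {e}" "e \<in> V" "p \<in> N e" "s e = s p" "q \<in> N e" "s e = s q"
        using moved[of p] moved[of q] eq by auto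
      \<comment> \<open>Two moved vertices with the same crossing neighbour \<open>e\<close> were
        both same-side neighbours of \<open>e\<close> before.\<close>
      then show False using same_side_unique[of e p q] ne by auto
    next
      case 2
      \<comment> \<open>Moved vertices have one crossing neighbour, unmoved ones at least
        two.\<close>
      then show False using moved[of p] card_unmoved[OF qV] eq by auto
    next
      case 3
      then show False using moved[of q] card_unmoved[OF pV] eq by auto
    next
      case 4
      have spq: "s p = s q" using 4 tpq by (simp add: t_def)
      have full: False if "cross t u = N u" "cross t u = cross t v" "u \<in> V" "v \<in> V" "u \<noteq> v" for u v
      proof -
        have "N u \<subseteq> N v" using that by (auto simp: cross_def)
        then have "N u = N v" using that card_N by (intro card_subset_eq) auto
        then show False using that N_inj by auto
      qed
      from unmoved[OF pV 4(1)] show False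
      proof (elim disjE exE conjE)
        assume "cross t p = N p"
        then show False using full[of p q] eq pV qV ne by simp
      next
        fix x y a' assume "conflict x y" "p \<in> cross s x" "N p = {x, y, a'}" "cross t p = {y, a'}"
        then show False using no_mid[of p q] pV qV 4 ne spq eq by metis
      next
        assume p: "cross t p = cross s p"
        from unmoved[OF qV 4(2)] show False
        proof (elim disjE exE conjE)
          assume "cross t q = N q"
          then show False using full[of q p] eq pV qV ne by simp
        next
          fix x y a' assume "conflict x y" "q \<in> cross s x" "N q = {x, y, a'}" "cross t q = {y, a'}"
          then show False using no_mid[of q p] pV qV 4 ne spq eq by metis
        next
          assume "cross t q = cross s q"
          \<comment> \<open>Both crossing sets are the original ones, so this is an original
            conflict, of which exactly one vertex was moved.\<close>
          then have "conflict p q" using p eq pV qV ne spq by (simp add: conflict_def)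
          then show False using S1 4 by blast
        qed
      qed
    qed
  qed
  ultimately have "locating_dominating_set G {v \<in> V. t v = c}" for c
    by (rule locating_dominating_setI)
  then show ?thesis by blast
qed

end

theorem theorem1:
  fixes G :: "'a pair_pre_digraph" and n :: nat
  assumes "pair_graph G"
    and "twin_free G"
    and "cubic G"
    and "card (pverts G) = n"
  shows "real (location_domination_number G) \<le> real n / 2"
proof -
  interpret pair_graph G by fact
  interpret twin_free_cubic_graph G by unfold_locales fact+
  obtain s where "\<forall>t. card (cut t) \<le> card (cut s)" using ex_max_cut by blast
  then interpret max_cut G s by unfold_locales blast
  obtain t :: "'a \<Rightarrow> bool" where t: "\<And>c. locating_dominating_set G {v \<in> V. t v = c}"
    using ex_locating_dominating_bipartition by blast
  \<comment> \<open>The two sides partition \<open>V\<close>, so their sizes, each at least the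
    location-domination number, add up to \<open>n\<close>.\<close>
  have "card {v \<in> V. t v = True} + card {v \<in> V. t v = False} =
      card ({v \<in> V. t v = True} \<union> {v \<in> V. t v = False})"
    by (rule card_Un_disjoint[symmetric]) auto
  also have "{v \<in> V. t v = True} \<union> {v \<in> V. t v = False} = V" by auto
  finally have "2 * location_domination_number G \<le> n"
    using location_domination_number_le[OF t[of True]] location_domination_number_le[OF t[of False]]
      assms(4) by linarith
  then show ?thesis by linarith
qed

end
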